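(* The set $\mathcal R_\theta$ of Cauchy sequences in $\mathcal O_K$ is a commutative ring with $1$ under componentwise addition and multiplication, and the subset $\mathcal M_\theta$ of Cauchy sequences converging to $0$ is a prime ideal of $\mathcal R_\theta$. Consequently $\widehat{\mathcal O}_\theta:=\mathcal R_\theta/\mathcal M_\theta$ is an integral domain.
   Context: $\theta>1$ is a real quadratic unit with $N(\theta)=-1$, so $\theta^2=a\theta+1$ with an integer $a\ge1$; $K=\mathbb Q(\theta)\subset\mathbb R$, $\mathcal O_K$ its ring of integers. A greedy polynomial is a finite sum $\sum_{i=m}^M b_i\theta^i$ with $b_i\in\{0,\dots,a\}$ such that $b_i=a$ implies $b_{i-1}=0$; every nonzero $\alpha\in\mathcal O_K$ is uniquely $\alpha=\pm\sum_{i=m}^Mb_i\theta^i$ greedy with $b_m\ne0$, and $|\alpha|_\theta:=\theta^{-m}$, $|0|_\theta=0$. A sequence $(f_n)$ in $\mathcal O_K$ is Cauchy if for every $\varepsilon>0$ there is $N$ with $|f_i-f_j|_\theta<\varepsilon$ for all $i,j\ge N$; it converges to $0$ if $|f_n|_\theta\to0$.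
   Formalization: The formal statement assumes O_K = Z[θ]; otherwise some elements of O_K have no greedy expansion and |·|_θ is undefined on them (e.g. a = 4, θ = 2+√5, α = (1+√5)/2). *)

theory Defs
  imports
    "HOL-Analysis.Analysis"
    "HOL-Algebra.Generated_Fields"
    "HOL-Algebra.QuotRing"
    "HOL-Computational_Algebra.Polynomial"
begin

definition real_ring :: "real ring" where
  "real_ring = \<lparr>carrier = UNIV, monoid.mult = (*), one = 1, zero = 0, add = (+)\<rparr>"

definition quadratic_field :: "real \<Rightarrow> real set" where
  "quadratic_field \<theta> = generate_field real_ring {\<theta>}"

definition integer_ring :: "real \<Rightarrow> real set" where
  "integer_ring \<theta> = {x \<in> quadratic_field \<theta>. algebraic_int x}"

definition Z_adjoin :: "real \<Rightarrow> real set" where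
  "Z_adjoin \<theta> = generate_ring real_ring {\<theta>}"

(* The digits of a greedy polynomial are extended by 0 outside {m..M}; exponents may be
   negative. The bounds m and M need not be tight here. *)
definition greedy_digits :: "int \<Rightarrow> int \<Rightarrow> int \<Rightarrow> (int \<Rightarrow> int) \<Rightarrow> bool" where
  "greedy_digits a m M b \<longleftrightarrow> m \<le> M \<and> (\<forall>i. i \<notin> {m..M} \<longrightarrow> b i = 0) \<and>
     (\<forall>i. b i \<in> {0..a}) \<and> (\<forall>i. b i = a \<longrightarrow> b (i - 1) = 0)"

definition greedy_value :: "real \<Rightarrow> int \<Rightarrow> int \<Rightarrow> (int \<Rightarrow> int) \<Rightarrow> real" where
  "greedy_value \<theta> m M b = (\<Sum>i = m..M. of_int (b i) * \<theta> powi i)"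

definition greedy_order :: "real \<Rightarrow> int \<Rightarrow> real \<Rightarrow> int \<Rightarrow> bool" where
  "greedy_order \<theta> a \<alpha> m \<longleftrightarrow> (\<exists>M b. greedy_digits a m M b \<and> b m \<noteq> 0 \<and>
     (\<alpha> = greedy_value \<theta> m M b \<or> \<alpha> = - greedy_value \<theta> m M b))"

(* Unspecified when \<alpha> is nonzero and has no greedy expansion. *)
definition theta_abs :: "real \<Rightarrow> int \<Rightarrow> real \<Rightarrow> real" where
  "theta_abs \<theta> a \<alpha> = (if \<alpha> = 0 then 0 else \<theta> powi (- (THE m. greedy_order \<theta> a \<alpha> m)))"

definition theta_Cauchy :: "real \<Rightarrow> int \<Rightarrow> (nat \<Rightarrow> real) \<Rightarrow> bool" where
  "theta_Cauchy \<theta> a f \<longleftrightarrow>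
     (\<forall>\<epsilon>>0. \<exists>N. \<forall>i\<ge>N. \<forall>j\<ge>N. theta_abs \<theta> a (f i - f j) < \<epsilon>)"

definition theta_null :: "real \<Rightarrow> int \<Rightarrow> (nat \<Rightarrow> real) \<Rightarrow> bool" where
  "theta_null \<theta> a f \<longleftrightarrow> (\<lambda>n. theta_abs \<theta> a (f n)) \<longlonglongrightarrow> 0"

definition Cauchy_ring :: "real \<Rightarrow> int \<Rightarrow> (nat \<Rightarrow> real) ring" where
  "Cauchy_ring \<theta> a =
     \<lparr>carrier = {f. (\<forall>n. f n \<in> integer_ring \<theta>) \<and> theta_Cauchy \<theta> a f},
      monoid.mult = (\<lambda>f g n. f n * g n), one = (\<lambda>n. 1),
      zero = (\<lambda>n. 0), add = (\<lambda>f g n. f n + g n)\<rparr>"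

definition null_ideal :: "real \<Rightarrow> int \<Rightarrow> (nat \<Rightarrow> real) set" where
  "null_ideal \<theta> a = {f \<in> carrier (Cauchy_ring \<theta> a). theta_null \<theta> a f}"

definition completion_ring :: "real \<Rightarrow> int \<Rightarrow> (nat \<Rightarrow> real) set ring" where
  "completion_ring \<theta> a = Cauchy_ring \<theta> a Quot null_ideal \<theta> a"

lemma real_ring_simps:
  "carrier real_ring = UNIV" "x \<otimes>\<^bsub>real_ring\<^esub> y = x * y" "\<one>\<^bsub>real_ring\<^esub> = 1"
  "\<zero>\<^bsub>real_ring\<^esub> = 0" "x \<oplus>\<^bsub>real_ring\<^esub> y = x + y"
  by (simp_all add: real_ring_def)

lemma cring_real_ring: "cring real_ring"
proof (rule cringI)
  show "abelian_group real_ring"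
  proof (rule abelian_groupI)
    fix x :: real
    show "\<exists>y\<in>carrier real_ring. y \<oplus>\<^bsub>real_ring\<^esub> x = \<zero>\<^bsub>real_ring\<^esub>"
      by (rule bexI[of _ "-x"]) (simp_all add: real_ring_simps)
  qed (simp_all add: real_ring_simps)
  show "Group.comm_monoid real_ring"
    by (rule comm_monoidI) (simp_all add: real_ring_simps)
qed (simp add: real_ring_simps algebra_simps)

lemma real_ring_minus: "\<ominus>\<^bsub>real_ring\<^esub> x = - x"
proof -
  interpret cring real_ring by (rule cring_real_ring)
  show ?thesis
    by (rule minus_equality) (simp_all add: real_ring_simps)
qed

lemma Z_adjoin_eq:
  assumes "\<theta>\<^sup>2 = of_int a * \<theta> + 1"
  shows "Z_adjoin \<theta> = {of_int p + of_int q * \<theta> | p q. True}"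
proof (intro equalityI subsetI)
  fix x assume "x \<in> Z_adjoin \<theta>"
  then have "x \<in> generate_ring real_ring {\<theta>}" by (simp add: Z_adjoin_def)
  then show "x \<in> {of_int p + of_int q * \<theta> | p q. True}"
  proof induction
    case one
    have "\<one>\<^bsub>real_ring\<^esub> = of_int 1 + of_int 0 * \<theta>" by (simp add: real_ring_simps)
    then show ?case by blast
  next
    case (incl h)
    then have "h = of_int 0 + of_int 1 * \<theta>" by simp
    then show ?case by blast
  next
    case (a_inv h)
    then obtain p q where "h = of_int p + of_int q * \<theta>" by blast
    then have "\<ominus>\<^bsub>real_ring\<^esub> h = of_int (- p) + of_int (- q) * \<theta>"
      by (simp add: real_ring_minus)
    then show ?case by blast
  next
    case (eng_add h k)
    then obtain p q r s where "h = of_int p + of_int q * \<theta>" "k = of_int r + of_int s * \<theta>"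
      by blast
    then have "h \<oplus>\<^bsub>real_ring\<^esub> k = of_int (p + r) + of_int (q + s) * \<theta>"
      by (simp add: real_ring_simps algebra_simps)
    then show ?case by blast
  next
    case (eng_mult h k)
    then obtain p q r s where hk: "h = of_int p + of_int q * \<theta>" "k = of_int r + of_int s * \<theta>"
      by blast
    have "h * k = of_int (p * r) + of_int (p * s + q * r) * \<theta> + of_int (q * s) * \<theta>\<^sup>2"
      by (simp add: hk algebra_simps power2_eq_square)
    also have "\<dots> = of_int (p * r + q * s) + of_int (p * s + q * r + q * s * a) * \<theta>"
      unfolding assms by (simp add: algebra_simps)
    finally have "h \<otimes>\<^bsub>real_ring\<^esub> k =
        of_int (p * r + q * s) + of_int (p * s + q * r + q * s * a) * \<theta>"
      by (simp add: real_ring_simps)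
    then show ?case by blast
  qed
next
  fix x assume "x \<in> {of_int p + of_int q * \<theta> | p q. True}"
  then obtain p q where x: "x = of_int p + of_int q * \<theta>" by blast
  interpret cring real_ring by (rule cring_real_ring)
  let ?Z = "generate_ring real_ring {\<theta>}"
  have add: "u + v \<in> ?Z" and mult: "u * v \<in> ?Z" if "u \<in> ?Z" "v \<in> ?Z" for u v
    using generate_ring.eng_add[OF that] generate_ring.eng_mult[OF that]
    by (simp_all add: real_ring_simps)
  have minus: "- u \<in> ?Z" if "u \<in> ?Z" for u
    using generate_ring.a_inv[OF that] by (simp add: real_ring_minus)
  have one: "1 \<in> ?Z" using generate_ring.one[of real_ring "{\<theta>}"] by (simp add: real_ring_simps)
  have zero: "0 \<in> ?Z" using add[OF one minus[OF one]] by simp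
  have nat: "of_nat n \<in> ?Z" for n
    by (induction n) (simp_all add: zero add[OF one])
  have int: "of_int k \<in> ?Z" for k
    by (cases k rule: int_cases2) (simp_all add: nat minus)
  have "\<theta> \<in> ?Z" by (rule generate_ring.incl) simp
  then show "x \<in> Z_adjoin \<theta>"
    unfolding x Z_adjoin_def by (intro add mult int)
qed

lemma Z_adjoin_subset_integer_ring:
  assumes "\<theta>\<^sup>2 = of_int a * \<theta> + 1"
  shows "Z_adjoin \<theta> \<subseteq> integer_ring \<theta>"
proof
  fix x assume x: "x \<in> Z_adjoin \<theta>"
  then have "x \<in> generate_ring real_ring {\<theta>}" by (simp add: Z_adjoin_def)
  then have K: "x \<in> quadratic_field \<theta>"
    unfolding quadratic_field_def by induction (auto intro: generate_field.intros)
  obtain p q where pq: "x = of_int p + of_int q * \<theta>"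
    using x Z_adjoin_eq[OF assms] by blast
  let ?P = "[:of_int (p\<^sup>2 + a * p * q - q\<^sup>2), of_int (- (2 * p + a * q)), 1:] :: real poly"
  have "poly ?P x = of_int q ^ 2 * (\<theta>\<^sup>2 - (of_int a * \<theta> + 1))"
    by (simp add: pq algebra_simps power2_eq_square)
  then have "poly ?P x = 0" by (simp add: assms)
  moreover have "lead_coeff ?P = 1" by simp
  moreover have "\<forall>i. Polynomial.coeff ?P i \<in> \<int>" by (auto simp: coeff_pCons split: nat.splits)
  ultimately have "algebraic_int x" by (metis algebraic_int.intros)
  with K show "x \<in> integer_ring \<theta>" by (simp add: integer_ring_def)
qed

(* If theta_abs is specified on all of the ring of integers, then that ring is Z[\<theta>]. *)
lemma integer_ring_eq_Z_adjoin:
  assumes \<theta>: "\<theta>\<^sup>2 = of_int a * \<theta> + 1"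
    and greedy: "\<And>\<alpha>. \<alpha> \<in> integer_ring \<theta> \<Longrightarrow> \<alpha> \<noteq> 0 \<Longrightarrow> \<exists>m. greedy_order \<theta> a \<alpha> m"
  shows "integer_ring \<theta> = Z_adjoin \<theta>"
proof
  note Z_eq = Z_adjoin_eq[OF \<theta>]
  have add: "u + v \<in> Z_adjoin \<theta>" and mult: "u * v \<in> Z_adjoin \<theta>"
    if "u \<in> Z_adjoin \<theta>" "v \<in> Z_adjoin \<theta>" for u v
    using generate_ring.eng_add[of u real_ring "{\<theta>}" v]
      generate_ring.eng_mult[of u real_ring "{\<theta>}" v] that
    by (simp_all add: real_ring_simps Z_adjoin_def)
  have int: "of_int k \<in> Z_adjoin \<theta>" for k
  proof -
    have "of_int k = of_int k + of_int 0 * \<theta>" by simp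
    then show ?thesis unfolding Z_eq by blast
  qed
  have gen: "\<theta> \<in> Z_adjoin \<theta>"
    unfolding Z_adjoin_def by (rule generate_ring.incl) simp
  have "\<theta> * (\<theta> - of_int a) = 1"
    using \<theta> by (simp add: algebra_simps power2_eq_square)
  then have "inverse \<theta> = \<theta> + of_int (- a)"
    by (metis inverse_unique of_int_minus uminus_add_conv_diff add.commute)
  then have inv: "inverse \<theta> \<in> Z_adjoin \<theta>"
    using add[OF gen int[of "- a"]] by simp
  have pow: "u ^ n \<in> Z_adjoin \<theta>" if "u \<in> Z_adjoin \<theta>" for u n
    by (induction n) (use int[of 1] in \<open>simp_all add: mult that\<close>)
  have powi: "\<theta> powi i \<in> Z_adjoin \<theta>" for i
    unfolding power_int_def by (simp add: pow gen inv)
  have sum: "(\<Sum>i\<in>A. of_int (b i) * \<theta> powi i) \<in> Z_adjoin \<theta>" if "finite A" for A b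
    using that by induction (use int[of 0] in \<open>simp_all add: add mult int powi\<close>)
  show "integer_ring \<theta> \<subseteq> Z_adjoin \<theta>"
  proof
    fix \<alpha> assume \<alpha>: "\<alpha> \<in> integer_ring \<theta>"
    show "\<alpha> \<in> Z_adjoin \<theta>"
    proof (cases "\<alpha> = 0")
      case True
      then show ?thesis using int[of 0] by simp
    next
      case False
      then obtain m M b
        where "\<alpha> = greedy_value \<theta> m M b \<or> \<alpha> = of_int (- 1) * greedy_value \<theta> m M b"
        using greedy[OF \<alpha>] unfolding greedy_order_def by auto
      moreover have "greedy_value \<theta> m M b \<in> Z_adjoin \<theta>"
        unfolding greedy_value_def by (rule sum) simp
      ultimately show ?thesis using mult[OF int[of "- 1"]] by auto
    qed
  qed
  show "Z_adjoin \<theta> \<subseteq> integer_ring \<theta>"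
    by (rule Z_adjoin_subset_integer_ring[OF \<theta>])
qed

end

theory Submission
  imports Defs
begin

text \<open>
  Let \<open>x \<mapsto> x'\<close> be the conjugation of \<open>\<int>[\<theta>]\<close>, which sends \<open>\<theta>\<close> to \<open>- 1 / \<theta>\<close>. If \<open>\<alpha> > 0\<close> has a greedy
  expansion with lowest exponent \<open>m\<close>, then \<open>\<alpha>' = (- 1 / \<theta>)\<^sup>m u\<close> where \<open>1 / \<theta> < u < \<theta>\<close>: the greedy
  condition controls the alternating sum \<open>u\<close>. Hence \<open>m\<close> is determined by \<open>\<alpha>\<close> (the sign of \<open>\<alpha>'\<close>
  fixes its parity, the size of \<open>\<alpha>'\<close> leaves at most two neighbouring values), and \<open>\<bar>\<alpha>\<bar>\<^sub>\<theta>\<close> agrees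
  with \<open>\<bar>\<alpha>'\<bar>\<close> up to a factor \<open>\<theta>\<close>. So a sequence \<open>f\<close> is Cauchy (or null) for \<open>\<bar>\<cdot>\<bar>\<^sub>\<theta>\<close> iff \<open>f'\<close> is so in \<open>\<real>\<close>,
  and the null sequences are the kernel of the ring homomorphism \<open>f \<mapsto> lim f'\<close> into the field \<open>\<real>\<close>.
\<close>

section \<open>Conjugation on \<open>\<int>[\<theta>]\<close>\<close>

locale quadratic_unit =
  fixes \<theta> :: real and a :: int
  assumes gt_1: "\<theta> > 1" and a_ge_1: "a \<ge> 1" and square: "\<theta>\<^sup>2 = of_int a * \<theta> + 1"
begin

text \<open>Meaningful only on \<open>Z_adjoin \<theta>\<close>, where irrationality of
  \<open>\<theta>\<close> makes the coordinates \<open>p\<close> and \<open>q\<close> unique;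
  \<open>- 1 / \<theta>\<close> is the second root of \<open>X^2 - a X - 1\<close>.\<close>

definition conjugate :: "real \<Rightarrow> real" where
  "conjugate x = (THE y. \<exists>p q. x = of_int p + of_int q * \<theta> \<and> y = of_int p - of_int q / \<theta>)"

lemma inverse_eq: "1 / \<theta> = \<theta> - of_int a"
  using gt_1 square by (simp add: field_simps power2_eq_square)

text \<open>A rational algebraic integer is an integer \<open>t\<close>, and
  \<open>t * (t - a) = 1\<close> would make \<open>t\<close> a unit of the integers, against
  \<open>t > 1\<close>.\<close>

lemma irrational: "\<theta> \<notin> \<rat>"
proof
  assume "\<theta> \<in> \<rat>"
  have "\<theta> \<in> Z_adjoin \<theta>"
    unfolding Z_adjoin_def by (rule generate_ring.incl) simp
  then have "algebraic_int \<theta>"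
    using Z_adjoin_subset_integer_ring[OF square] by (auto simp: integer_ring_def)
  then obtain t :: int where t: "\<theta> = of_int t"
    using \<open>\<theta> \<in> \<rat>\<close> rational_algebraic_int_is_int by (metis Ints_cases)
  have "real_of_int (t * (t - a)) = of_int 1"
    using square by (simp add: t algebra_simps power2_eq_square)
  then have "t * (t - a) = 1" by (simp only: of_int_eq_iff)
  moreover have "t > 1" using gt_1 by (simp add: t)
  ultimately show False by (auto simp: zmult_eq_1_iff)
qed

lemma coordinates_unique:
  assumes "real_of_int p + of_int q * \<theta> = of_int r + of_int s * \<theta>"
  shows "p = r \<and> q = s"
proof -
  have "q = s"
  proof (rule ccontr)
    assume "q \<noteq> s"
    then have "\<theta> = of_int (r - p) / of_int (q - s)"
      using assms by (simp add: field_simps)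
    then show False using irrational by (metis Rats_divide Rats_of_int)
  qed
  with assms show ?thesis by simp
qed

lemma conjugate_eq: "conjugate (of_int p + of_int q * \<theta>) = of_int p - of_int q / \<theta>"
  unfolding conjugate_def by (rule the_equality) (use coordinates_unique in blast)+

lemma mem_Z_adjoinE:
  assumes "x \<in> Z_adjoin \<theta>"
  obtains p q where "x = of_int p + of_int q * \<theta>" "conjugate x = of_int p - of_int q / \<theta>"
  using assms conjugate_eq unfolding Z_adjoin_eq[OF square] by auto

lemma mem_Z_adjoinI: "of_int p + of_int q * \<theta> \<in> Z_adjoin \<theta>"
  unfolding Z_adjoin_eq[OF square] by blast

lemma int_mem: "of_int k \<in> Z_adjoin \<theta>" and conjugate_int: "conjugate (of_int k) = of_int k"
  using mem_Z_adjoinI[of k 0] conjugate_eq[of k 0] by simp_all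

lemma theta_mem: "\<theta> \<in> Z_adjoin \<theta>" and conjugate_theta: "conjugate \<theta> = - 1 / \<theta>"
  using mem_Z_adjoinI[of 0 1] conjugate_eq[of 0 1] by simp_all

lemma
  assumes "x \<in> Z_adjoin \<theta>" "y \<in> Z_adjoin \<theta>"
  shows add_mem: "x + y \<in> Z_adjoin \<theta>"
    and conjugate_add: "conjugate (x + y) = conjugate x + conjugate y"
    and mult_mem: "x * y \<in> Z_adjoin \<theta>"
    and conjugate_mult: "conjugate (x * y) = conjugate x * conjugate y"
proof -
  obtain p q where x: "x = of_int p + of_int q * \<theta>" "conjugate x = of_int p - of_int q / \<theta>"
    using mem_Z_adjoinE[OF assms(1)] .
  obtain r s where y: "y = of_int r + of_int s * \<theta>" "conjugate y = of_int r - of_int s / \<theta>"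
    using mem_Z_adjoinE[OF assms(2)] .
  have add: "x + y = of_int (p + r) + of_int (q + s) * \<theta>"
    by (simp add: x y algebra_simps)
  show "x + y \<in> Z_adjoin \<theta>" "conjugate (x + y) = conjugate x + conjugate y"
    unfolding add by (simp_all only: mem_Z_adjoinI conjugate_eq x(2) y(2)) (simp add: add_divide_distrib)
  have "x * y = of_int (p * r) + of_int (p * s + q * r) * \<theta> + of_int (q * s) * \<theta>\<^sup>2"
    by (simp add: x y algebra_simps power2_eq_square)
  also have "\<dots> = of_int (p * r + q * s) + of_int (p * s + q * r + q * s * a) * \<theta>"
    unfolding square by (simp add: algebra_simps)
  finally have mult:
    "x * y = of_int (p * r + q * s) + of_int (p * s + q * r + q * s * a) * \<theta>" .
  \<comment> \<open>The conjugate root \<open>- 1 / \<theta>\<close> satisfies the same quadratic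
    equation, so its square is \<open>1 - a / \<theta>\<close>. This is what makes conjugation
    multiplicative.\<close>
  have "(1 / \<theta>) * (1 / \<theta>) = (1 / \<theta>) * (\<theta> - of_int a)"
    by (rule arg_cong[OF inverse_eq])
  also have "\<dots> = 1 - of_int a * (1 / \<theta>)"
    using gt_1 by (simp add: right_diff_distrib)
  finally have "of_int (q * s) * ((1 / \<theta>) * (1 / \<theta>)) = of_int (q * s) * (1 - of_int a * (1 / \<theta>))"
    by (rule arg_cong)
  then show "x * y \<in> Z_adjoin \<theta>" "conjugate (x * y) = conjugate x * conjugate y"
    unfolding mult
    by (simp_all only: mem_Z_adjoinI conjugate_eq x(2) y(2)) (simp add: algebra_simps add_divide_distrib)
qed

lemma
  assumes "x \<in> Z_adjoin \<theta>"
  shows minus_mem: "- x \<in> Z_adjoin \<theta>"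
    and conjugate_minus: "conjugate (- x) = - conjugate x"
  using mult_mem[OF int_mem[of "-1"] assms] conjugate_mult[OF int_mem[of "-1"] assms]
    conjugate_int[of "-1"] by simp_all

lemma
  assumes "x \<in> Z_adjoin \<theta>" "y \<in> Z_adjoin \<theta>"
  shows diff_mem: "x - y \<in> Z_adjoin \<theta>"
    and conjugate_diff: "conjugate (x - y) = conjugate x - conjugate y"
  using add_mem[OF assms(1) minus_mem[OF assms(2)]] conjugate_add[OF assms(1) minus_mem[OF assms(2)]]
    conjugate_minus[OF assms(2)] by simp_all

lemma
  assumes "x \<in> Z_adjoin \<theta>"
  shows power_mem: "x ^ n \<in> Z_adjoin \<theta>"
    and conjugate_power: "conjugate (x ^ n) = conjugate x ^ n"
proof -
  have "x ^ n \<in> Z_adjoin \<theta> \<and> conjugate (x ^ n) = conjugate x ^ n"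
  proof (induction n)
    case 0
    show ?case using int_mem[of 1] conjugate_int[of 1] by simp
  qed (simp add: mult_mem conjugate_mult assms)
  then show "x ^ n \<in> Z_adjoin \<theta>" "conjugate (x ^ n) = conjugate x ^ n" by auto
qed

text \<open>Since \<open>\<theta>\<close> is a unit with inverse \<open>\<theta> - a\<close>,
  negative powers also stay in \<open>Z_adjoin \<theta>\<close>, and conjugation can be applied to
  greedy values with negative exponents.\<close>

lemma inverse_theta_mem: "inverse \<theta> \<in> Z_adjoin \<theta>"
  and conjugate_inverse_theta: "conjugate (inverse \<theta>) = inverse (- 1 / \<theta>)"
proof -
  have eq: "inverse \<theta> = \<theta> - of_int a"
    using inverse_eq by (simp add: inverse_eq_divide)
  show "inverse \<theta> \<in> Z_adjoin \<theta>"
    unfolding eq by (intro diff_mem theta_mem int_mem)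
  have "conjugate (inverse \<theta>) = - (1 / \<theta>) - of_int a"
    unfolding eq by (simp add: conjugate_diff theta_mem int_mem conjugate_theta conjugate_int)
  also have "\<dots> = inverse (- 1 / \<theta>)" unfolding inverse_eq by (simp add: inverse_eq_divide)
  finally show "conjugate (inverse \<theta>) = inverse (- 1 / \<theta>)" .
qed

lemma powi_mem: "\<theta> powi i \<in> Z_adjoin \<theta>"
  and conjugate_powi: "conjugate (\<theta> powi i) = (- 1 / \<theta>) powi i"
  unfolding power_int_def
  by (simp_all add: power_mem theta_mem inverse_theta_mem conjugate_power conjugate_theta
      conjugate_inverse_theta)

lemma conjugate_greedy_value:
  "greedy_value \<theta> m M b \<in> Z_adjoin \<theta> \<and> conjugate (greedy_value \<theta> m M b) = greedy_value (- 1 / \<theta>) m M b"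
proof -
  have "(\<Sum>i\<in>A. of_int (b i) * \<theta> powi i) \<in> Z_adjoin \<theta> \<and>
      conjugate (\<Sum>i\<in>A. of_int (b i) * \<theta> powi i) = (\<Sum>i\<in>A. of_int (b i) * (- 1 / \<theta>) powi i)"
    if "finite A" for A
    using that
  proof induction
    case empty
    show ?case using int_mem[of 0] conjugate_int[of 0] by simp
  next
    case (insert x F)
    then show ?case
      by (simp add: add_mem mult_mem int_mem powi_mem conjugate_add conjugate_mult conjugate_int
          conjugate_powi del: divide_minus_left)
  qed
  then show ?thesis unfolding greedy_value_def by blast
qed

section \<open>Size of the conjugate of a greedy value\<close>

lemma greedy_value_rec:
  assumes "m \<le> M"
  shows "greedy_value x m M b = of_int (b m) * x powi m + greedy_value x (m + 1) M b"
proof -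
  have "{m..M} = insert m {m+1..M}" using assms by auto
  then show ?thesis by (simp add: greedy_value_def)
qed

text \<open>A Horner step from the top digit downwards: once the lowest power is factored out,
  adding the digit \<open>d\<close> below turns the cofactor \<open>u\<close> into
  \<open>d - u / \<theta>\<close>.\<close>

lemma conjugate_value_rec:
  assumes "m \<le> M" "greedy_value (- 1 / \<theta>) (m + 1) M b = (- 1 / \<theta>) powi (m + 1) * u"
  shows "greedy_value (- 1 / \<theta>) m M b = (- 1 / \<theta>) powi m * (of_int (b m) - u / \<theta>)"
proof -
  have "(- 1 / \<theta>) powi (m + 1) = (- 1 / \<theta>) powi m * (- 1 / \<theta>)"
    using gt_1 by (intro power_int_add_1) simp
  then show ?thesis
    unfolding greedy_value_rec[OF assms(1)] assms(2) by (simp add: algebra_simps)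
qed

lemma digit_bounds:
  assumes "greedy_digits a m M b"
  shows "0 \<le> b i" "b i \<le> a" "b i = a \<Longrightarrow> b (i - 1) = 0" "i \<notin> {m..M} \<Longrightarrow> b i = 0"
  using assms unfolding greedy_digits_def by auto

text \<open>The interval \<open>(-1, \<theta>)\<close> is stable under \<open>u \<mapsto> d - u / \<theta>\<close> for every digit \<open>d\<close>.\<close>

lemma conjugate_value_bound:
  assumes "greedy_digits a m M b"
  shows "\<exists>u. greedy_value (- 1 / \<theta>) (M + 1 - int n) M b = (- 1 / \<theta>) powi (M + 1 - int n) * u \<and>
    - 1 < u \<and> u < \<theta> \<and> (n > 0 \<longrightarrow> u < of_int (b (M + 1 - int n)) + 1 / \<theta>)"
proof (induction n)
  case 0
  show ?case using gt_1 by (intro exI[of _ 0]) (simp add: greedy_value_def)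
next
  case (Suc n)
  define k where "k = M - int n"
  have k: "M + 1 - int (Suc n) = k" "M + 1 - int n = k + 1" by (auto simp: k_def)
  obtain u where u: "greedy_value (- 1 / \<theta>) (k + 1) M b = (- 1 / \<theta>) powi (k + 1) * u" "- 1 < u" "u < \<theta>"
    using Suc unfolding k by blast
  have "greedy_value (- 1 / \<theta>) k M b = (- 1 / \<theta>) powi k * (of_int (b k) - u / \<theta>)"
    by (rule conjugate_value_rec[OF _ u(1)]) (simp add: k_def)
  \<comment> \<open>With a digit between 0 and \<open>a\<close>, these two bounds place the new
    cofactor strictly between \<open>- 1\<close> and \<open>a + 1 / \<theta> = \<theta>\<close>. The
    first one alone gives the sharper bound in terms of the actual digit.\<close>
  moreover have "- u / \<theta> < 1 / \<theta>" "u / \<theta> < 1" using u gt_1 by (simp_all add: field_simps)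
  moreover have "0 \<le> real_of_int (b k)" "real_of_int (b k) \<le> of_int a"
    using digit_bounds[OF assms] by auto
  ultimately show ?case using inverse_eq unfolding k
    by (intro exI[of _ "of_int (b k) - u / \<theta>"]) auto
qed

text \<open>A nonzero digit at \<open>m\<close> forbids the digit \<open>a\<close> at
  \<open>m + 1\<close>. Hence the cofactor \<open>v\<close> above \<open>m\<close> is less than
  \<open>(a - 1) + 1 / \<theta> = \<theta> - 1\<close>, and \<open>u = b m - v / \<theta>\<close>
  exceeds \<open>1 - (\<theta> - 1) / \<theta> = 1 / \<theta>\<close>.\<close>

lemma conjugate_value_unit:
  assumes "greedy_digits a m M b" "b m \<noteq> 0"
  obtains u where "greedy_value (- 1 / \<theta>) m M b = (- 1 / \<theta>) powi m * u" "1 / \<theta> < u" "u < \<theta>"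
proof -
  note d = digit_bounds[OF assms(1)]
  have mM: "m \<le> M" using assms(1) by (simp add: greedy_digits_def)
  obtain u where u: "greedy_value (- 1 / \<theta>) m M b = (- 1 / \<theta>) powi m * u" "u < \<theta>"
    using conjugate_value_bound[OF assms(1), of "nat (M + 1 - m)"] mM by auto
  obtain v where v: "greedy_value (- 1 / \<theta>) (m + 1) M b = (- 1 / \<theta>) powi (m + 1) * v"
      "v < \<theta>" "m < M \<Longrightarrow> v < of_int (b (m + 1)) + 1 / \<theta>"
    using conjugate_value_bound[OF assms(1), of "nat (M - m)"] mM by (auto simp: algebra_simps)
  have ne: "(- 1 / \<theta>) powi m \<noteq> 0" using gt_1 by simp
  have "greedy_value (- 1 / \<theta>) m M b = (- 1 / \<theta>) powi m * (of_int (b m) - v / \<theta>)"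
    by (rule conjugate_value_rec[OF mM v(1)])
  then have uv: "u = of_int (b m) - v / \<theta>"
    unfolding u(1) by (rule mult_left_cancel[OF ne, THEN iffD1])
  have "b (m + 1) \<noteq> a" using d(3)[of "m + 1"] assms(2) by auto
  then have "b (m + 1) \<le> a - 1" using d(2)[of "m + 1"] by simp
  then have small: "real_of_int (b (m + 1)) \<le> of_int a - 1" by linarith
  have "v < \<theta> - 1"
  proof (cases "m < M")
    case True
    then show ?thesis using v(3) small inverse_eq by simp
  next
    case False
    \<comment> \<open>Here \<open>m = M\<close>, so the sum above \<open>m\<close> is empty and
      \<open>v = 0\<close>.\<close>
    then have "greedy_value (- 1 / \<theta>) (m + 1) M b = 0" by (simp add: greedy_value_def)
    then show ?thesis using v(1) gt_1 by simp
  qed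
  then have "v / \<theta> < (\<theta> - 1) / \<theta>" using gt_1 by (intro divide_strict_right_mono) auto
  moreover have "(\<theta> - 1) / \<theta> = 1 - 1 / \<theta>" using gt_1 by (simp add: field_simps)
  moreover have "1 \<le> b m" using d(1)[of m] assms(2) by simp
  then have "1 \<le> real_of_int (b m)" by simp
  ultimately have "1 / \<theta> < u" unfolding uv by linarith
  then show thesis by (rule that[OF u(1) _ u(2)])
qed

text \<open>This identifies the sign chosen in \<open>greedy_order\<close> with
  \<open>sgn \<alpha>\<close>, so two expansions of the same number carry the same sign.\<close>

lemma greedy_value_pos:
  assumes "greedy_digits a m M b" "b m \<noteq> 0"
  shows "greedy_value \<theta> m M b > 0"
  unfolding greedy_value_def
proof (rule sum_pos2[of _ m])
  show "m \<in> {m..M}" using assms(1) by (simp add: greedy_digits_def)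
  show "0 < of_int (b m) * \<theta> powi m"
    using digit_bounds(1)[OF assms(1), of m] assms(2) gt_1 by simp
qed (use digit_bounds(1)[OF assms(1)] gt_1 in auto)

section \<open>Uniqueness of the greedy order\<close>

lemma greedy_order_conjugate:
  assumes "greedy_order \<theta> a \<alpha> m"
  obtains u where "conjugate \<alpha> = sgn \<alpha> * ((- 1 / \<theta>) powi m * u)" "1 / \<theta> < u" "u < \<theta>" "\<alpha> \<noteq> 0"
proof -
  obtain M b where b: "greedy_digits a m M b" "b m \<noteq> 0"
    and \<alpha>: "\<alpha> = greedy_value \<theta> m M b \<or> \<alpha> = - greedy_value \<theta> m M b"
    using assms unfolding greedy_order_def by blast
  note pos = greedy_value_pos[OF b]
  obtain u where u: "greedy_value (- 1 / \<theta>) m M b = (- 1 / \<theta>) powi m * u" "1 / \<theta> < u" "u < \<theta>"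
    by (rule conjugate_value_unit[OF b])
  have "conjugate (greedy_value \<theta> m M b) = (- 1 / \<theta>) powi m * u"
    using conjugate_greedy_value u(1) by simp
  then have "conjugate \<alpha> = sgn \<alpha> * ((- 1 / \<theta>) powi m * u)" "\<alpha> \<noteq> 0"
    using \<alpha> pos conjugate_greedy_value[of m M b] conjugate_minus[of "greedy_value \<theta> m M b"] by auto
  with u(2,3) show thesis by (intro that)
qed

text \<open>Two orders \<open>m\<close> and \<open>n = m + k\<close> would give
  \<open>u = (- 1 / \<theta>) ^ k * v\<close> with \<open>u\<close> and \<open>v\<close> both
  between \<open>1 / \<theta>\<close> and \<open>\<theta>\<close>. For odd \<open>k\<close> the
  signs differ; for even \<open>k \<ge> 2\<close> the right side is below
  \<open>\<theta> / \<theta>^2 = 1 / \<theta>\<close>.\<close>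

lemma greedy_order_not_less:
  assumes "greedy_order \<theta> a \<alpha> m" "greedy_order \<theta> a \<alpha> n"
  shows "\<not> m < n"
proof
  assume "m < n"
  define k where "k = nat (n - m)"
  have k: "n = m + int k" "k > 0" using \<open>m < n\<close> by (auto simp: k_def)
  obtain u where u: "conjugate \<alpha> = sgn \<alpha> * ((- 1 / \<theta>) powi m * u)" "1 / \<theta> < u" "u < \<theta>" "\<alpha> \<noteq> 0"
    by (rule greedy_order_conjugate[OF assms(1)])
  obtain v where v: "conjugate \<alpha> = sgn \<alpha> * ((- 1 / \<theta>) powi n * v)" "1 / \<theta> < v" "v < \<theta>"
    by (rule greedy_order_conjugate[OF assms(2)])
  have ne: "(- 1 / \<theta>) \<noteq> 0" "(- 1 / \<theta>) powi m \<noteq> 0" using gt_1 by auto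
  have "(- 1 / \<theta>) powi m * u = (- 1 / \<theta>) powi m * ((- 1 / \<theta>) ^ k * v)"
    using u(1,4) v(1) ne unfolding k by (simp add: power_int_add sgn_if split: if_splits)
  then have uv: "u = (- 1 / \<theta>) ^ k * v" using ne by simp
  have "0 < 1 / \<theta>" using gt_1 by simp
  then have pos: "0 < u" "0 < v" using u(2) v(2) by linarith+
  show False
  proof (cases "even k")
    case False
    then have "(- 1 / \<theta>) ^ k < 0" using gt_1 by (simp add: power_divide)
    then have "(- 1 / \<theta>) ^ k * v < 0" using pos by (intro mult_neg_pos)
    then show False using uv pos by simp
  next
    case True
    then have "2 \<le> k" using k(2) by auto
    have "(- 1 / \<theta>) ^ k = (1 / \<theta>) ^ k" using True by (simp add: power_divide)
    also have "\<dots> \<le> (1 / \<theta>) ^ 2" using \<open>2 \<le> k\<close> gt_1 by (intro power_decreasing) auto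
    finally have "u \<le> (1 / \<theta>)\<^sup>2 * v" unfolding uv using pos by (intro mult_right_mono) auto
    also have "\<dots> < (1 / \<theta>)\<^sup>2 * \<theta>" using v(3) gt_1 by (intro mult_strict_left_mono) auto
    also have "\<dots> = 1 / \<theta>" using gt_1 by (simp add: power2_eq_square)
    finally show False using u(2) by simp
  qed
qed

lemma greedy_order_unique:
  assumes "greedy_order \<theta> a \<alpha> m"
  shows "(THE m. greedy_order \<theta> a \<alpha> m) = m"
  by (rule the_equality[of _ m]) (use assms greedy_order_not_less linorder_neqE in metis)+

section \<open>Existence of greedy expansions\<close>

definition fractional :: "real \<Rightarrow> bool" where
  "fractional x \<longleftrightarrow> (\<exists>m b. greedy_digits a m (- 1) b \<and> x = greedy_value \<theta> m (- 1) b)"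

lemma greedy_value_shift:
  "greedy_value \<theta> (m + n) (M + n) (\<lambda>i. b (i - n)) = \<theta> powi n * greedy_value \<theta> m M b"
proof -
  have "greedy_value \<theta> (m + n) (M + n) (\<lambda>i. b (i - n)) = (\<Sum>i = m..M. of_int (b i) * \<theta> powi (i + n))"
    unfolding greedy_value_def
    by (rule sum.reindex_bij_witness[of _ "\<lambda>i. i + n" "\<lambda>i. i - n"]) auto
  also have "\<dots> = \<theta> powi n * greedy_value \<theta> m M b"
    using gt_1 by (simp add: greedy_value_def sum_distrib_left power_int_add algebra_simps)
  finally show ?thesis .
qed

text \<open>One step of the greedy algorithm read backwards: the digit
  \<open>d = \<lfloor>\<theta> * x\<rfloor>\<close> is put in front of the expansion of the
  remainder. It is at most \<open>a\<close> because \<open>\<theta> * x < \<theta> < a + 1\<close>.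
  If \<open>d = a\<close>, the remainder is below \<open>\<theta> - a = 1 / \<theta>\<close>, so its
  digit at \<open>- 1\<close> vanishes, as the greedy condition requires.\<close>

lemma fractional_extend:
  assumes "0 \<le> x" "x < 1" "fractional (\<theta> * x - of_int \<lfloor>\<theta> * x\<rfloor>)"
  shows "fractional x"
proof -
  define d where "d = \<lfloor>\<theta> * x\<rfloor>"
  obtain m b where b: "greedy_digits a m (- 1) b" and val: "\<theta> * x - of_int d = greedy_value \<theta> m (- 1) b"
    using assms(3) unfolding fractional_def d_def by blast
  note dig = digit_bounds[OF b]
  have m: "m \<le> - 1" using b by (simp add: greedy_digits_def)
  have less: "\<theta> * x < \<theta>" using assms gt_1 by simp
  have "1 / \<theta> < 1" using gt_1 by simp
  with inverse_eq less have "\<theta> * x < of_int a + 1" by linarith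
  then have d: "0 \<le> d" "d \<le> a" using assms gt_1 unfolding d_def by (auto simp: floor_le_iff)
  have b1: "b (- 1) = 0" if "d = a"
  proof -
    have "of_int (b (- 1)) * \<theta> powi (- 1) \<le> greedy_value \<theta> m (- 1) b"
      unfolding greedy_value_def by (rule member_le_sum) (use m dig(1) gt_1 in auto)
    also have "\<dots> < 1 / \<theta>" using val less inverse_eq that by simp
    finally have "b (- 1) < 1" using gt_1 by (simp add: power_int_minus field_simps)
    then show ?thesis using dig(1)[of "- 1"] by simp
  qed
  define c where "c = (\<lambda>i. if i = - 1 then d else b (i + 1))"
  have "greedy_digits a (m - 1) (- 1) c"
    unfolding greedy_digits_def
  proof (intro conjI allI impI)
    show "m - 1 \<le> - 1" using m by simp
    fix i
    show "c i = 0" if "i \<notin> {m - 1..- 1}"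
      using that m dig(4)[of "i + 1"] by (auto simp: c_def)
    show "c i \<in> {0..a}" using d dig(1,2) by (auto simp: c_def)
    \<comment> \<open>For \<open>i \<ge> 0\<close> the digit is 0, which differs from
      \<open>a\<close> as \<open>a \<ge> 1\<close>; so nothing forces the new digit \<open>d\<close>
      at \<open>- 1\<close> to vanish.\<close>
    show "c (i - 1) = 0" if "c i = a"
      using that b1 dig(3)[of "i + 1"] dig(4)[of "i + 1"] a_ge_1 by (auto simp: c_def split: if_splits)
  qed
  moreover have "greedy_value \<theta> (m - 1) (- 1) c = x"
  proof -
    have "{m - 1..- 1} = insert (- 1) {m - 1..- 2}" using m by auto
    then have "greedy_value \<theta> (m - 1) (- 1) c = of_int d * \<theta> powi (- 1) + greedy_value \<theta> (m - 1) (- 2) c"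
      by (simp add: greedy_value_def c_def)
    also have "greedy_value \<theta> (m - 1) (- 2) c = greedy_value \<theta> (m + - 1) (- 1 + - 1) (\<lambda>i. b (i - - 1))"
      unfolding greedy_value_def by (intro sum.cong) (auto simp: c_def)
    also have "\<dots> = \<theta> powi (- 1) * (\<theta> * x - of_int d)"
      unfolding greedy_value_shift val ..
    finally show ?thesis using gt_1 by (simp add: power_int_minus field_simps)
  qed
  ultimately show ?thesis unfolding fractional_def by metis
qed

text \<open>
  Along the orbit of the greedy algorithm \<open>- x'\<close> contracts towards the interval \<open>[-1, \<theta>]\<close>; once
  it is close enough, \<open>x\<close> is \<open>0\<close> or \<open>1 / \<theta>\<close>.
\<close>

lemma fractional_if_conjugate_bounded:
  assumes "x \<in> Z_adjoin \<theta>" "0 \<le> x" "x < 1"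
    and "- 1 - \<theta> ^ k / \<theta> \<le> - conjugate x" "- conjugate x \<le> \<theta> + \<theta> ^ k / \<theta>"
  shows "fractional x"
  using assms
proof (induction k arbitrary: x)
  case 0
  obtain p q where pq: "x = of_int p + of_int q * \<theta>" "conjugate x = of_int p - of_int q / \<theta>"
    using mem_Z_adjoinE[OF 0(1)] .
  \<comment> \<open>The difference isolates \<open>q\<close>. It is at least
    \<open>- 1 - 1 / \<theta>\<close> and less than \<open>1 + \<theta> + 1 / \<theta>\<close>,
    which leaves only \<open>q = 0\<close> and \<open>q = 1\<close>.\<close>
  have diff: "x - conjugate x = of_int q * (\<theta> + 1 / \<theta>)"
    using pq by (simp add: algebra_simps)
  have inv: "0 < 1 / \<theta>" "1 / \<theta> < 1" using gt_1 by auto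
  have zero: "fractional 0"
    unfolding fractional_def greedy_digits_def greedy_value_def
    by (intro exI[of _ "- 1"] exI[of _ "\<lambda>_. 0"]) (use a_ge_1 in auto)
  have "q > - 1"
  proof (rule ccontr)
    assume "\<not> q > - 1"
    then have "real_of_int q \<le> - 1" by linarith
    then have "of_int q * (\<theta> + 1 / \<theta>) \<le> - 1 * (\<theta> + 1 / \<theta>)"
      using gt_1 inv by (intro mult_right_mono) auto
    then show False using diff 0 gt_1 by simp
  qed
  moreover have "q < 2"
  proof (rule ccontr)
    assume "\<not> q < 2"
    then have "2 \<le> real_of_int q" by linarith
    then have "2 * (\<theta> + 1 / \<theta>) \<le> of_int q * (\<theta> + 1 / \<theta>)"
      using gt_1 inv by (intro mult_right_mono) auto
    then show False using diff 0 gt_1 inv by simp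
  qed
  ultimately consider "q = 0" | "q = 1" by linarith
  then show ?case
  proof cases
    case 1
    then have "x = 0" using pq(1) 0 by auto
    then show ?thesis using zero by simp
  next
    case 2
    then have x: "x = of_int (p + a) + 1 / \<theta>" using pq(1) inverse_eq by simp
    then have "- 1 < real_of_int (p + a)" "real_of_int (p + a) < 1" using 0(2,3) inv by linarith+
    then have "p + a = 0" by linarith
    \<comment> \<open>Thus \<open>x = 1 / \<theta>\<close>: one greedy step emits the digit 1 and
      leaves the remainder 0.\<close>
    then have "\<theta> * x = 1" using x gt_1 by simp
    then show ?thesis using fractional_extend[OF 0(2,3)] zero by simp
  qed
next
  case (Suc k)
  define d where "d = \<lfloor>\<theta> * x\<rfloor>"
  have "\<theta> * x < \<theta>" using Suc.prems gt_1 by simp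
  moreover have "1 / \<theta> < 1" using gt_1 by simp
  ultimately have "\<theta> * x < of_int a + 1" using inverse_eq by linarith
  then have "0 \<le> d" "d \<le> a" using Suc.prems gt_1 unfolding d_def by (auto simp: floor_le_iff)
  then have d: "0 \<le> real_of_int d" "real_of_int d \<le> of_int a" by auto
  have "fractional (\<theta> * x - of_int d)"
  proof (rule Suc.IH)
    show "\<theta> * x - of_int d \<in> Z_adjoin \<theta>"
      by (intro diff_mem mult_mem theta_mem int_mem Suc.prems)
    show "0 \<le> \<theta> * x - of_int d" "\<theta> * x - of_int d < 1"
      unfolding d_def by linarith+
    have conj: "- conjugate (\<theta> * x - of_int d) = of_int d + conjugate x / \<theta>"
      by (simp add: conjugate_diff conjugate_mult mult_mem theta_mem int_mem conjugate_theta
          conjugate_int Suc.prems)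
    \<comment> \<open>Dividing by \<open>\<theta>\<close> reduces the excess
      \<open>\<theta> ^ Suc k / \<theta>\<close> to \<open>\<theta> ^ k / \<theta>\<close> and
      exchanges the roles of the two ends. Adding a digit between 0 and \<open>a\<close> restores
      the shape of the bounds, as \<open>a + 1 / \<theta> = \<theta>\<close>.\<close>
    have "- (\<theta> + \<theta> ^ Suc k / \<theta>) / \<theta> \<le> conjugate x / \<theta>" "conjugate x / \<theta> \<le> (1 + \<theta> ^ Suc k / \<theta>) / \<theta>"
      using Suc.prems gt_1 by (intro divide_right_mono; simp)+
    moreover have "- (\<theta> + \<theta> ^ Suc k / \<theta>) / \<theta> = - 1 - \<theta> ^ k / \<theta>"
      "(1 + \<theta> ^ Suc k / \<theta>) / \<theta> = 1 / \<theta> + \<theta> ^ k / \<theta>"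
      using gt_1 by (simp_all add: field_simps)
    ultimately show "- 1 - \<theta> ^ k / \<theta> \<le> - conjugate (\<theta> * x - of_int d)"
      "- conjugate (\<theta> * x - of_int d) \<le> \<theta> + \<theta> ^ k / \<theta>"
      unfolding conj using d inverse_eq by linarith+
  qed
  then show ?case unfolding d_def by (rule fractional_extend[OF Suc.prems(2,3)])
qed

lemma fractional_exists:
  assumes "x \<in> Z_adjoin \<theta>" "0 \<le> x" "x < 1"
  shows "fractional x"
proof -
  obtain k where "\<theta> * \<bar>conjugate x\<bar> < \<theta> ^ k" using real_arch_pow[OF gt_1] by blast
  then have "\<bar>conjugate x\<bar> < \<theta> ^ k / \<theta>" using gt_1 by (simp add: field_simps)
  then show ?thesis using gt_1
    by (intro fractional_if_conjugate_bounded[OF assms, of k]) linarith+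
qed

text \<open>A power of \<open>\<theta>\<close> scales \<open>\<bar>\<alpha>\<bar>\<close> into the
  interval from 0 to 1, where a fractional expansion exists. Shifting the exponents back and
  trimming zero digits at the low end gives the expansion of \<open>\<alpha>\<close> up to
  sign.\<close>

lemma greedy_order_exists:
  assumes "\<alpha> \<in> Z_adjoin \<theta>" "\<alpha> \<noteq> 0"
  shows "\<exists>m. greedy_order \<theta> a \<alpha> m"
proof -
  have mem: "\<bar>\<alpha>\<bar> \<in> Z_adjoin \<theta>" using assms minus_mem by (simp add: abs_if)
  obtain n where n: "\<bar>\<alpha>\<bar> < \<theta> ^ n" using real_arch_pow[OF gt_1] by blast
  define x where "x = \<theta> powi (- int n) * \<bar>\<alpha>\<bar>"
  have "fractional x"
  proof (rule fractional_exists)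
    show "x \<in> Z_adjoin \<theta>" unfolding x_def by (intro mult_mem powi_mem mem)
    show "0 \<le> x" "x < 1" using gt_1 n by (simp_all add: x_def power_int_minus field_simps)
  qed
  then obtain m b where b: "greedy_digits a m (- 1) b" and x: "x = greedy_value \<theta> m (- 1) b"
    unfolding fractional_def by blast
  define M where "M = - 1 + int n"
  define c where "c = (\<lambda>i. b (i - int n))"
  have \<alpha>: "\<bar>\<alpha>\<bar> = greedy_value \<theta> (m + int n) M c"
    using gt_1 x unfolding M_def c_def greedy_value_shift
    by (simp add: x_def power_int_minus field_simps)
  note dig = digit_bounds[OF b]
  \<comment> \<open>The lower bound supplied by \<open>fractional\<close> need not be tight;
    \<open>Min A\<close> will be the true lowest exponent, and \<open>A\<close> is nonempty because
    \<open>\<alpha> \<noteq> 0\<close>.\<close>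
  define A where "A = {i \<in> {m + int n..M}. c i \<noteq> 0}"
  have "A \<noteq> {}"
  proof
    assume "A = {}"
    then have "greedy_value \<theta> (m + int n) M c = 0"
      unfolding greedy_value_def by (intro sum.neutral) (auto simp: A_def)
    then show False using \<alpha> assms by simp
  qed
  have "A \<subseteq> {m + int n..M}" unfolding A_def by blast
  then have fin: "finite A" by (rule finite_subset) simp
  have "Min A \<in> A" using fin \<open>A \<noteq> {}\<close> by (rule Min_in)
  moreover have "m + int n \<le> i \<and> i \<le> M \<and> c i \<noteq> 0" if "i \<in> A" for i
    using that by (simp add: A_def)
  ultimately have l: "m + int n \<le> Min A" "Min A \<le> M" "c (Min A) \<noteq> 0" by blast+
  have below: "c i = 0" if "i < Min A" for i
  proof (rule ccontr)
    assume "c i \<noteq> 0"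
    then have "i \<in> A" using dig(4)[of "i - int n"] unfolding A_def c_def M_def by force
    then show False using that fin by (meson Min_le not_le)
  qed
  have "greedy_digits a (Min A) M c"
    unfolding greedy_digits_def
  proof (intro conjI allI impI)
    show "Min A \<le> M" by (rule l(2))
    fix i
    show "c i = 0" if "i \<notin> {Min A..M}"
      using that below[of i] dig(4)[of "i - int n"] by (force simp: c_def M_def)
    show "c i \<in> {0..a}" using dig by (auto simp: c_def)
    show "c (i - 1) = 0" if "c i = a"
      using that dig(3)[of "i - int n"] by (simp add: c_def algebra_simps)
  qed
  moreover have "greedy_value \<theta> (m + int n) M c = greedy_value \<theta> (Min A) M c"
    unfolding greedy_value_def
    by (rule sum.mono_neutral_right) (use l(1) below in auto)
  moreover note l(3)
  moreover have "\<alpha> = \<bar>\<alpha>\<bar> \<or> \<alpha> = - \<bar>\<alpha>\<bar>" by linarith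
  ultimately have "greedy_order \<theta> a \<alpha> (Min A)"
    unfolding greedy_order_def using \<alpha> by metis
  then show ?thesis ..
qed

section \<open>Comparison of \<open>theta_abs\<close> with the absolute value of the
  conjugate\<close>

lemma theta_abs_bounds:
  assumes "\<alpha> \<in> Z_adjoin \<theta>"
  shows "\<bar>conjugate \<alpha>\<bar> \<le> \<theta> * theta_abs \<theta> a \<alpha>" "theta_abs \<theta> a \<alpha> \<le> \<theta> * \<bar>conjugate \<alpha>\<bar>"
proof -
  have "\<bar>conjugate \<alpha>\<bar> \<le> \<theta> * theta_abs \<theta> a \<alpha> \<and> theta_abs \<theta> a \<alpha> \<le> \<theta> * \<bar>conjugate \<alpha>\<bar>"
  proof (cases "\<alpha> = 0")
    case True
    then show ?thesis using conjugate_int[of 0] by (simp add: theta_abs_def)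
  next
    case False
    obtain m where m: "greedy_order \<theta> a \<alpha> m" using greedy_order_exists[OF assms False] by blast
    obtain u where u: "conjugate \<alpha> = sgn \<alpha> * ((- 1 / \<theta>) powi m * u)" "1 / \<theta> < u" "u < \<theta>"
      by (rule greedy_order_conjugate[OF m])
    have "0 < 1 / \<theta>" using gt_1 by simp
    then have "0 < u" using u(2) by linarith
    have abs: "theta_abs \<theta> a \<alpha> = \<theta> powi (- m)"
      using False greedy_order_unique[OF m] by (simp add: theta_abs_def)
    have "\<bar>conjugate \<alpha>\<bar> = \<theta> powi (- m) * u"
      using False gt_1 \<open>0 < u\<close>
      by (simp add: u(1) abs_mult abs_sgn_eq power_int_abs power_int_minus power_int_divide_distrib
          field_simps)
    \<comment> \<open>As \<open>\<bar>conjugate \<alpha>\<bar>\<close> is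
      \<open>theta_abs \<theta> a \<alpha>\<close> times \<open>u\<close>, the two claims come down
      to \<open>u \<le> \<theta>\<close> and \<open>1 \<le> \<theta> * u\<close>.\<close>
    moreover have "\<theta> powi (- m) > 0" "1 \<le> \<theta> * u" using gt_1 u(2) by (simp_all add: field_simps)
    ultimately show ?thesis unfolding abs using u(3) gt_1 by (simp add: algebra_simps)
  qed
  then show "\<bar>conjugate \<alpha>\<bar> \<le> \<theta> * theta_abs \<theta> a \<alpha>" "theta_abs \<theta> a \<alpha> \<le> \<theta> * \<bar>conjugate \<alpha>\<bar>"
    by auto
qed

text \<open>The two-sided comparison applies to the differences because conjugation is additive; the
  factor \<open>\<theta>\<close> is absorbed by passing from \<open>e\<close> to
  \<open>e / \<theta>\<close>.\<close>

lemma theta_Cauchy_iff: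
  assumes "\<And>n. f n \<in> Z_adjoin \<theta>"
  shows "theta_Cauchy \<theta> a f \<longleftrightarrow> Cauchy (\<lambda>n. conjugate (f n))"
proof
  have bounds: "\<bar>conjugate (f i) - conjugate (f j)\<bar> \<le> \<theta> * theta_abs \<theta> a (f i - f j)"
    "theta_abs \<theta> a (f i - f j) \<le> \<theta> * \<bar>conjugate (f i) - conjugate (f j)\<bar>" for i j
    using theta_abs_bounds[OF diff_mem[OF assms assms], of i j] conjugate_diff[OF assms assms, of i j]
    by simp_all
  show "Cauchy (\<lambda>n. conjugate (f n))" if C: "theta_Cauchy \<theta> a f"
    unfolding Cauchy_def dist_real_def
  proof (intro allI impI)
    fix e :: real assume "0 < e"
    then have "0 < e / \<theta>" using gt_1 by simp
    then obtain N where "\<forall>i\<ge>N. \<forall>j\<ge>N. theta_abs \<theta> a (f i - f j) < e / \<theta>"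
      using C unfolding theta_Cauchy_def by blast
    then have "\<theta> * theta_abs \<theta> a (f i - f j) < e" if "i \<ge> N" "j \<ge> N" for i j
      using that gt_1 by (simp add: field_simps)
    then show "\<exists>N. \<forall>i\<ge>N. \<forall>j\<ge>N. \<bar>conjugate (f i) - conjugate (f j)\<bar> < e"
      using bounds(1) order.strict_trans1 by blast
  qed
  show "theta_Cauchy \<theta> a f" if C: "Cauchy (\<lambda>n. conjugate (f n))"
    unfolding theta_Cauchy_def
  proof (intro allI impI)
    fix e :: real assume "0 < e"
    then have "0 < e / \<theta>" using gt_1 by simp
    then obtain N where "\<forall>i\<ge>N. \<forall>j\<ge>N. \<bar>conjugate (f i) - conjugate (f j)\<bar> < e / \<theta>"
      using C unfolding Cauchy_def dist_real_def by blast
    then have "\<theta> * \<bar>conjugate (f i) - conjugate (f j)\<bar> < e" if "i \<ge> N" "j \<ge> N" for i j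
      using that gt_1 by (simp add: field_simps)
    then show "\<exists>N. \<forall>i\<ge>N. \<forall>j\<ge>N. theta_abs \<theta> a (f i - f j) < e"
      using bounds(2) order.strict_trans1 by blast
  qed
qed

lemma theta_null_iff:
  assumes "\<And>n. f n \<in> Z_adjoin \<theta>"
  shows "theta_null \<theta> a f \<longleftrightarrow> (\<lambda>n. conjugate (f n)) \<longlonglongrightarrow> 0"
proof
  note bounds = theta_abs_bounds[OF assms]
  have nonneg: "0 \<le> theta_abs \<theta> a x" for x using gt_1 by (simp add: theta_abs_def)
  show "(\<lambda>n. conjugate (f n)) \<longlonglongrightarrow> 0" if "theta_null \<theta> a f"
  proof (rule Lim_null_comparison)
    show "\<forall>\<^sub>F n in sequentially. norm (conjugate (f n)) \<le> \<theta> * theta_abs \<theta> a (f n)"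
      using bounds(1) by simp
    show "(\<lambda>n. \<theta> * theta_abs \<theta> a (f n)) \<longlonglongrightarrow> 0"
      using that unfolding theta_null_def by (rule tendsto_mult_right_zero)
  qed
  show "theta_null \<theta> a f" if "(\<lambda>n. conjugate (f n)) \<longlonglongrightarrow> 0"
    unfolding theta_null_def
  proof (rule Lim_null_comparison)
    show "\<forall>\<^sub>F n in sequentially. norm (theta_abs \<theta> a (f n)) \<le> \<theta> * \<bar>conjugate (f n)\<bar>"
      using bounds(2) nonneg by simp
    show "(\<lambda>n. \<theta> * \<bar>conjugate (f n)\<bar>) \<longlonglongrightarrow> 0"
      by (intro tendsto_mult_right_zero tendsto_rabs_zero that)
  qed
qed

end

section \<open>The ring of Cauchy sequences and its null ideal\<close>

locale integrally_closed_quadratic_unit = quadratic_unit +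
  assumes integers: "integer_ring \<theta> = Z_adjoin \<theta>"
begin

lemma Cauchy_ring_simps:
  "f \<otimes>\<^bsub>Cauchy_ring \<theta> a\<^esub> g = (\<lambda>n. f n * g n)" "\<one>\<^bsub>Cauchy_ring \<theta> a\<^esub> = (\<lambda>n. 1)"
  "\<zero>\<^bsub>Cauchy_ring \<theta> a\<^esub> = (\<lambda>n. 0)" "f \<oplus>\<^bsub>Cauchy_ring \<theta> a\<^esub> g = (\<lambda>n. f n + g n)"
  by (simp_all add: Cauchy_ring_def)

text \<open>Completeness of the reals turns the Cauchy condition into convergence of the conjugates,
  so closure under the ring operations follows from the limit rules.\<close>

lemma mem_Cauchy_ring_iff:
  "f \<in> carrier (Cauchy_ring \<theta> a) \<longleftrightarrow>
    (\<forall>n. f n \<in> Z_adjoin \<theta>) \<and> convergent (\<lambda>n. conjugate (f n))"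
  using theta_Cauchy_iff by (auto simp: Cauchy_ring_def integers Cauchy_convergent_iff)

lemma const_mem: "(\<lambda>n. of_int k) \<in> carrier (Cauchy_ring \<theta> a)"
  by (simp add: mem_Cauchy_ring_iff int_mem convergent_const)

lemma
  assumes "f \<in> carrier (Cauchy_ring \<theta> a)" "g \<in> carrier (Cauchy_ring \<theta> a)"
  shows Cauchy_ring_add_mem: "(\<lambda>n. f n + g n) \<in> carrier (Cauchy_ring \<theta> a)"
    and Cauchy_ring_mult_mem: "(\<lambda>n. f n * g n) \<in> carrier (Cauchy_ring \<theta> a)"
  using assms
  by (auto simp: mem_Cauchy_ring_iff add_mem mult_mem conjugate_add conjugate_mult
      intro: convergent_add convergent_mult)

lemma Cauchy_ring_minus_mem:
  "f \<in> carrier (Cauchy_ring \<theta> a) \<Longrightarrow> (\<lambda>n. - f n) \<in> carrier (Cauchy_ring \<theta> a)"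
  by (auto simp: mem_Cauchy_ring_iff minus_mem conjugate_minus simp flip: convergent_minus_iff)

lemma cring_Cauchy_ring: "cring (Cauchy_ring \<theta> a)"
proof (rule cringI)
  show "abelian_group (Cauchy_ring \<theta> a)"
  proof (rule abelian_groupI)
    fix f assume "f \<in> carrier (Cauchy_ring \<theta> a)"
    then show "\<exists>g\<in>carrier (Cauchy_ring \<theta> a). g \<oplus>\<^bsub>Cauchy_ring \<theta> a\<^esub> f = \<zero>\<^bsub>Cauchy_ring \<theta> a\<^esub>"
      by (intro bexI[of _ "\<lambda>n. - f n"]) (auto simp: Cauchy_ring_simps Cauchy_ring_minus_mem)
  qed (use const_mem[of 0] in \<open>auto simp: Cauchy_ring_simps Cauchy_ring_add_mem algebra_simps\<close>)
  show "Group.comm_monoid (Cauchy_ring \<theta> a)"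
    by (rule comm_monoidI)
      (use const_mem[of 1] in \<open>auto simp: Cauchy_ring_simps Cauchy_ring_mult_mem algebra_simps\<close>)
qed (simp add: Cauchy_ring_simps algebra_simps)

text \<open>On the carrier of \<open>Cauchy_ring \<theta> a\<close> the limit exists. The induced
  map on the quotient embeds the completion into the reals.\<close>

definition conjugate_lim :: "(nat \<Rightarrow> real) \<Rightarrow> real" where
  "conjugate_lim f = lim (\<lambda>n. conjugate (f n))"

lemma conjugate_lim_hom: "conjugate_lim \<in> ring_hom (Cauchy_ring \<theta> a) real_ring"
proof (rule ring_hom_memI)
  fix f g assume fg: "f \<in> carrier (Cauchy_ring \<theta> a)" "g \<in> carrier (Cauchy_ring \<theta> a)"
  then have lim: "(\<lambda>n. conjugate (f n)) \<longlonglongrightarrow> conjugate_lim f" "(\<lambda>n. conjugate (g n)) \<longlonglongrightarrow> conjugate_lim g"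
    and mem: "f n \<in> Z_adjoin \<theta>" "g n \<in> Z_adjoin \<theta>" for n
    by (auto simp: mem_Cauchy_ring_iff conjugate_lim_def convergent_LIMSEQ_iff)
  show "conjugate_lim (f \<otimes>\<^bsub>Cauchy_ring \<theta> a\<^esub> g) = conjugate_lim f \<otimes>\<^bsub>real_ring\<^esub> conjugate_lim g"
    using limI[OF tendsto_mult[OF lim]]
    by (simp add: Cauchy_ring_simps real_ring_simps conjugate_lim_def conjugate_mult mem)
  show "conjugate_lim (f \<oplus>\<^bsub>Cauchy_ring \<theta> a\<^esub> g) = conjugate_lim f \<oplus>\<^bsub>real_ring\<^esub> conjugate_lim g"
    using limI[OF tendsto_add[OF lim]]
    by (simp add: Cauchy_ring_simps real_ring_simps conjugate_lim_def conjugate_add mem)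
next
  show "conjugate_lim \<one>\<^bsub>Cauchy_ring \<theta> a\<^esub> = \<one>\<^bsub>real_ring\<^esub>"
    using conjugate_int[of 1] by (simp add: Cauchy_ring_simps real_ring_simps conjugate_lim_def)
qed (simp add: real_ring_simps)

text \<open>The null sequences are the kernel of \<open>conjugate_lim\<close>, written as the
  preimage of a singleton to match the form of \<open>primeideal_vimage\<close>.\<close>

lemma null_ideal_eq:
  "null_ideal \<theta> a = {f \<in> carrier (Cauchy_ring \<theta> a). conjugate_lim f \<in> {\<zero>\<^bsub>real_ring\<^esub>}}"
  using theta_null_iff
  by (auto simp: null_ideal_def mem_Cauchy_ring_iff conjugate_lim_def real_ring_simps
      convergent_LIMSEQ_iff dest: limI)

lemma domain_real_ring: "domain real_ring"
  by (rule domain.intro[OF cring_real_ring]) (simp add: domain_axioms_def real_ring_simps)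

text \<open>The zero ideal of a domain is prime, and the preimage of a prime ideal under a
  homomorphism of commutative rings is prime.\<close>

lemma primeideal_null_ideal: "primeideal (null_ideal \<theta> a) (Cauchy_ring \<theta> a)"
proof -
  interpret ring_hom_ring "Cauchy_ring \<theta> a" real_ring conjugate_lim
    by (rule ring_hom_ringI2[OF cring.axioms(1)[OF cring_Cauchy_ring]
          cring.axioms(1)[OF cring_real_ring] conjugate_lim_hom])
  show ?thesis
    unfolding null_ideal_eq
    by (rule primeideal_vimage[OF cring_Cauchy_ring domain.zeroprimeideal[OF domain_real_ring]])
qed

end

theorem theorem10:
  fixes \<theta> :: real and a :: int
  assumes "\<theta> > 1" and "a \<ge> 1" and "\<theta>\<^sup>2 = of_int a * \<theta> + 1"
    and "integer_ring \<theta> = Z_adjoin \<theta>"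
  shows "cring (Cauchy_ring \<theta> a)
    \<and> primeideal (null_ideal \<theta> a) (Cauchy_ring \<theta> a)
    \<and> domain (completion_ring \<theta> a)"
proof -
  interpret integrally_closed_quadratic_unit \<theta> a
    by unfold_locales (use assms in auto)
  show ?thesis
    using cring_Cauchy_ring primeideal_null_ideal
      primeideal.quotient_is_domain[OF primeideal_null_ideal]
    by (simp add: completion_ring_def)
qed

end
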